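(* Let $a \ge 0$ be a fixed real number and, for each integer $n \ge 1$, let $$I_n(a) = \int_{(0,1)^n} \frac{\sum_{i=1}^n x_i^a}{\sum_{i=1}^n \sin(\pi x_i)} \, \mathrm{d}x_1 \cdots \mathrm{d}x_n.$$ Then $$\lim_{n \to \infty} I_n(a) = \frac{\pi}{2(a+1)}.$$
   Context: The integrals are Lebesgue integrals of positive measurable functions over the open unit cube $(0,1)^n$, with values in $[0,\infty]$. *)

theory Defs
  imports "HOL-Analysis.Analysis"
begin

text \<open>
  The integral takes values in \<open>[0,\<infinity>]\<close>: it is \<open>\<infinity>\<close> for \<open>n = 1\<close>, so it is a nonnegative
  Lebesgue integral, not a Bochner integral (which would be \<open>0\<close> there).
  Since \<open>n\<close> varies, \<open>n\<close>-dimensional Lebesgue measure is the product measure on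
  functions indexed by \<open>{1..n}\<close>.
\<close>

definition open_unit_cube :: "nat \<Rightarrow> (nat \<Rightarrow> real) set" where
  "open_unit_cube n = {1..n} \<rightarrow>\<^sub>E {0<..<1}"

definition I :: "nat \<Rightarrow> real \<Rightarrow> ennreal" where
  "I n a = (\<integral>\<^sup>+ x \<in> open_unit_cube n.
      ennreal ((\<Sum>i=1..n. x i powr a) / (\<Sum>i=1..n. sin (pi * x i)))
      \<partial>(\<Pi>\<^sub>M i\<in>{1..n}. lborel))"

end

theory Submission
  imports Defs "HOL-Probability.Probability_Measure" "HOL-Real_Asymp.Real_Asymp"
begin

text \<open>
  Over the cube the coordinates are independent and uniform on \<open>(0,1)\<close>.  With \<open>f t = t powr a\<close> and
  \<open>s t = sin (pi * t)\<close>, the integral \<open>I n a\<close> is the expectation of \<open>A / S\<close>, where \<open>A\<close> and \<open>S\<close>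
  are the sums of \<open>f\<close> and of \<open>s\<close> over \<open>n\<close> samples.  By the law of large numbers \<open>A / S\<close> should be
  close to the quotient \<open>(1 / (a + 1)) / (2 / pi)\<close> of the two means; the difficulty is that \<open>1 / S\<close> is
  unbounded, and for \<open>n = 1\<close> not even integrable.

  Let \<open>m\<close> be the mean of \<open>s\<close> and \<open>c = n * m\<close>.  The exact expansion
  \<open>A / S = A / c - A * (S - c) / c\<^sup>2 + A * (S - c)\<^sup>2 / (c\<^sup>2 * S)\<close> (\<open>divide_expand\<close>) leaves a singularity
  only in its last term.  The first term has the limit as its expectation for every \<open>n\<close>, and the second one
  is \<open>O(1 / n)\<close> because only the \<open>n\<close> diagonal covariances survive (\<open>covariance_le\<close>).  For the last
  term, \<open>1 / S\<close> is dominated by a sum of functions of two coordinates each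
  (\<open>inverse_sum_le_sum_neighbours\<close>): for \<open>w\<close> with \<open>1 \<le> s * w\<^sup>2\<close>,
  \<open>1 / S \<le> (n - 1) powi (-2) * (\<Sum>i=1..<n. w (x i) * w (x (i + 1)))\<close>.
  The point is that \<open>w\<close> can behave like \<open>1 / sqrt s\<close>, which is integrable although \<open>1 / s\<close> is not.
  The factor \<open>w (x i) * w (x j)\<close> destroys the orthogonality of the deviations in the coordinates \<open>i\<close> and
  \<open>j\<close> only, so \<open>(S - c)\<^sup>2\<close> weighted by it still has expectation \<open>O(n)\<close>
  (\<open>weighted_variance_le\<close>), and the last term is \<open>O(1 / n)\<close> too.

  For the sine, \<open>w = 1 / sqrt (t * (1 - t))\<close> works: \<open>t * (1 - t) \<le> sin (pi * t)\<close> by concavity, and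
  the integral of \<open>w\<close> is \<open>Beta (1/2) (1/2)\<close>.
\<close>

section \<open>Restricting a product measure to a box\<close>

text \<open>
  This turns the integral over the cube into an expectation over a product of probability measures whose
  underlying space is the cube itself, so that positivity of the sine holds at every point
  rather than almost everywhere.
\<close>

lemma restrict_space_PiM_PiE:
  assumes fin: "finite K" and prod: "product_sigma_finite M"
    and A: "\<And>i. A i \<in> sets (M i)"
  shows "restrict_space (PiM K M) (PiE K A) = PiM K (\<lambda>i. restrict_space (M i) (A i))"
proof -
  interpret M: product_sigma_finite M by (fact prod)
  interpret R: product_sigma_finite "\<lambda>i. restrict_space (M i) (A i)"
    by standard
      (intro sigma_finite_measure.sigma_finite_countable sigma_finite_measure_restrict_space
        M.sigma_finite_measures A)
  have box: "PiE K A \<in> sets (PiM K M)"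
    using fin A by (intro sets_PiM_I_finite) auto
  show ?thesis
  proof (rule R.PiM_eqI[OF fin])
    show "sets (restrict_space (PiM K M) (PiE K A)) = sets (PiM K (\<lambda>i. restrict_space (M i) (A i)))"
      (is "sets ?L = sets ?R")
    proof
      have "(\<lambda>x i. x i) \<in> measurable ?L ?R"
      proof (rule measurable_PiM_single')
        fix i assume i: "i \<in> K"
        show "(\<lambda>x. x i) \<in> measurable ?L (restrict_space (M i) (A i))"
          using i box A by (intro measurable_restrict_space2 measurable_restrict_space1) auto
      qed (use box A in \<open>auto simp: PiE_def\<close>)
      then have id: "(\<lambda>x. x) \<in> measurable ?L ?R" .
      have sp: "space ?L = space ?R" using box A by (simp add: space_PiM)
      show "sets ?R \<subseteq> sets ?L"
      proof
        fix B assume B: "B \<in> sets ?R"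
        with measurable_sets[OF id B] sets.sets_into_space[OF B] sp show "B \<in> sets ?L"
          by (simp add: Int_absorb2 vimage_def)
      qed
      have "(\<lambda>x i. x i) \<in> measurable ?R (PiM K M)"
      proof (rule measurable_PiM_single')
        fix i assume i: "i \<in> K"
        have "(\<lambda>x. x i) \<in> measurable ?R (restrict_space (M i) (A i))"
          using i by (rule measurable_component_singleton)
        then show "(\<lambda>x. x i) \<in> measurable ?R (M i)"
          by (simp add: measurable_restrict_space2_iff)
      next
        show "(\<lambda>x i. x i) \<in> space ?R \<rightarrow> (\<Pi>\<^sub>E i\<in>K. space (M i))"
        proof (rule funcsetI)
          fix x assume "x \<in> space ?R"
          then have "x \<in> PiE K A" using A by (simp add: space_PiM)
          also have "\<dots> \<subseteq> (\<Pi>\<^sub>E i\<in>K. space (M i))"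
            by (intro PiE_mono sets.sets_into_space A)
          finally show "(\<lambda>i. x i) \<in> (\<Pi>\<^sub>E i\<in>K. space (M i))" .
        qed
      qed
      then have id': "(\<lambda>x. x) \<in> measurable ?R (PiM K M)" .
      show "sets ?L \<subseteq> sets ?R"
      proof
        fix B assume "B \<in> sets ?L"
        then have B: "B \<subseteq> PiE K A" "B \<in> sets (PiM K M)"
          using box by (auto simp: sets_restrict_space_iff)
        with measurable_sets[OF id' B(2)] show "B \<in> sets ?R"
          using A by (simp add: space_PiM Int_absorb2 vimage_def)
      qed
    qed
  next
    fix B assume "\<And>i. i \<in> K \<Longrightarrow> B i \<in> sets (restrict_space (M i) (A i))"
    then have B: "\<And>i. i \<in> K \<Longrightarrow> B i \<subseteq> A i" "\<And>i. i \<in> K \<Longrightarrow> B i \<in> sets (M i)"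
      using A by (auto simp: sets_restrict_space_iff)
    interpret F: finite_product_sigma_finite M K by standard (fact fin)
    have "emeasure (restrict_space (PiM K M) (PiE K A)) (PiE K B) = emeasure (PiM K M) (PiE K B)"
      using B box by (intro emeasure_restrict_space) (auto intro: PiE_mono)
    also have "\<dots> = (\<Prod>i\<in>K. emeasure (M i) (B i))"
      using B by (intro F.measure_times) auto
    also have "\<dots> = (\<Prod>i\<in>K. emeasure (restrict_space (M i) (A i)) (B i))"
      using A B by (intro prod.cong refl emeasure_restrict_space[symmetric]) auto
    finally show "emeasure (restrict_space (PiM K M) (PiE K A)) (PiE K B)
        = (\<Prod>i\<in>K. emeasure (restrict_space (M i) (A i)) (B i))" .
  qed
qed

section \<open>Estimates for reciprocals\<close>

text \<open>
  The second-order expansion of \<open>1 / S\<close> about \<open>c\<close>, with exact remainder.  The remainder is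
  nonnegative when \<open>A\<close> and \<open>S\<close> are, so it also gives the tangent line bound for \<open>1 / S\<close>.
\<close>

lemma divide_expand:
  fixes A S c :: real
  assumes "S \<noteq> 0" "c \<noteq> 0"
  shows "A / S = A / c - A * (S - c) / c\<^sup>2 + A * (S - c)\<^sup>2 / (c\<^sup>2 * S)"
  using assms by (simp add: field_simps power2_eq_square)

text \<open>
  Neighbouring pairs satisfy \<open>2 \<le> (s i + s (i + 1)) * (w i * w (i + 1))\<close> by the inequality of
  arithmetic and geometric means.  Each entry lies in at most two such pairs, so convexity of the reciprocal,
  applied to the \<open>n - 1\<close> pair sums, gives the bound.
\<close>

lemma inverse_sum_le_sum_neighbours:
  fixes s w :: "nat \<Rightarrow> real"
  assumes n: "2 \<le> n"
    and s: "\<And>i. i \<in> {1..n} \<Longrightarrow> 0 < s i"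
    and w: "\<And>i. i \<in> {1..n} \<Longrightarrow> 0 \<le> w i"
    and sw: "\<And>i. i \<in> {1..n} \<Longrightarrow> 1 \<le> s i * (w i)\<^sup>2"
  shows "1 / (\<Sum>i=1..n. s i) \<le> (\<Sum>i=1..<n. w i * w (Suc i)) / (real n - 1)\<^sup>2"
proof -
  define S where "S = (\<Sum>i=1..n. s i)"
  define N where "N = real n - 1"
  \<comment> \<open>The pair sums add up to at most \<open>2 * S\<close>; their reciprocals are bounded below by the tangent at this
    upper bound for their mean.\<close>
  define c where "c = 2 * S / N"
  have S: "0 < S" unfolding S_def using n s by (intro sum_pos) auto
  have N: "0 < N" using n by (simp add: N_def)
  have c: "0 < c" using S N by (simp add: c_def)
  have tangent: "4 / c - 2 * (s i + s (Suc i)) / c\<^sup>2 \<le> w i * w (Suc i)" if i: "i \<in> {1..<n}" for i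
  proof -
    let ?u = "s i + s (Suc i)" and ?v = "w i * w (Suc i)"
    have mem: "i \<in> {1..n}" "Suc i \<in> {1..n}" using i by auto
    have u: "0 < ?u" using s mem by (simp add: add_pos_pos)
    have wpos: "0 < w j" if "j \<in> {1..n}" for j
      using w[OF that] sw[OF that] by (cases "w j = 0") auto
    have sge: "1 / (w j)\<^sup>2 \<le> s j" if "j \<in> {1..n}" for j
      using sw[OF that] wpos[OF that] by (simp add: divide_le_eq)
    have "2 / ?v \<le> 1 / (w i)\<^sup>2 + 1 / (w (Suc i))\<^sup>2"
      using sum_squares_bound[of "1 / w i" "1 / w (Suc i)"] by (simp add: power_divide)
    also have "\<dots> \<le> ?u" using sge mem by (intro add_mono) auto
    finally have "2 / ?u \<le> ?v"
      using u wpos[OF mem(1)] wpos[OF mem(2)] by (simp add: field_simps)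
    moreover have "4 / c - 2 * ?u / c\<^sup>2 \<le> 2 / ?u"
    proof -
      have "2 / ?u - (4 / c - 2 * ?u / c\<^sup>2) = 2 * (?u - c)\<^sup>2 / (c\<^sup>2 * ?u)"
        using divide_expand[of ?u c 2] u c by (simp add: field_simps power2_eq_square)
      also have "\<dots> \<ge> 0" using u by simp
      finally show ?thesis by simp
    qed
    ultimately show ?thesis by linarith
  qed
  have "(\<Sum>i=1..<n. s i) \<le> S"
    unfolding S_def using s by (intro sum_mono2) (auto intro: less_imp_le)
  moreover have "(\<Sum>i=1..<n. s (Suc i)) \<le> S"
  proof -
    have "(\<Sum>i=1..<n. s (Suc i)) = (\<Sum>i\<in>{2..n}. s i)"
      by (rule sum.reindex_bij_witness[of _ "\<lambda>i. i - 1" Suc]) auto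
    also have "\<dots> \<le> S"
      unfolding S_def using s by (intro sum_mono2) (auto intro: less_imp_le)
    finally show ?thesis .
  qed
  ultimately have u: "(\<Sum>i=1..<n. s i + s (Suc i)) \<le> 2 * S"
    by (simp add: sum.distrib)
  have "N\<^sup>2 / S = 4 * N / c - 2 * (2 * S) / c\<^sup>2"
    using S N by (simp add: c_def field_simps power2_eq_square)
  also have "\<dots> \<le> 4 * N / c - 2 * (\<Sum>i=1..<n. s i + s (Suc i)) / c\<^sup>2"
    using u c by (intro diff_left_mono divide_right_mono mult_left_mono) auto
  also have "\<dots> = (\<Sum>i=1..<n. 4 / c - 2 * (s i + s (Suc i)) / c\<^sup>2)"
    using n by (simp add: N_def sum_subtractf sum_distrib_left sum_divide_distrib of_nat_diff)
  also have "\<dots> \<le> (\<Sum>i=1..<n. w i * w (Suc i))"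
    using tangent by (rule sum_mono)
  finally show ?thesis
    using S N unfolding S_def[symmetric] N_def[symmetric] by (simp add: field_simps)
qed

lemma integral_double_sum:
  fixes g :: "'i \<Rightarrow> 'j \<Rightarrow> 'a \<Rightarrow> real"
  assumes "\<And>k l. k \<in> K \<Longrightarrow> l \<in> L \<Longrightarrow> integrable N (g k l)"
  shows "(\<integral>x. (\<Sum>k\<in>K. \<Sum>l\<in>L. g k l x) \<partial>N) = (\<Sum>k\<in>K. \<Sum>l\<in>L. \<integral>x. g k l x \<partial>N)"
proof -
  have "(\<integral>x. (\<Sum>k\<in>K. \<Sum>l\<in>L. g k l x) \<partial>N) = (\<Sum>k\<in>K. \<integral>x. (\<Sum>l\<in>L. g k l x) \<partial>N)"
    using assms by (intro Bochner_Integration.integral_sum Bochner_Integration.integrable_sum)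
  also have "\<dots> = (\<Sum>k\<in>K. \<Sum>l\<in>L. \<integral>x. g k l x \<partial>N)"
    using assms by (intro sum.cong refl Bochner_Integration.integral_sum)
  finally show ?thesis .
qed

section \<open>The ratio of two sums over independent samples\<close>

text \<open>
  The function \<open>w\<close> is an integrable majorant of \<open>1 / sqrt s\<close>; it is the only control of the smallness
  of \<open>s\<close>.
\<close>

locale ratio_of_sums = prob_space M for M :: "'a measure" +
  fixes f s w :: "'a \<Rightarrow> real"
  assumes f_meas [measurable]: "f \<in> borel_measurable M"
    and s_meas [measurable]: "s \<in> borel_measurable M"
    and w_int: "integrable M w"
    and f_bounds: "\<And>x. x \<in> space M \<Longrightarrow> 0 \<le> f x \<and> f x \<le> 1"
    and s_bounds: "\<And>x. x \<in> space M \<Longrightarrow> 0 < s x \<and> s x \<le> 1"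
    and w_nonneg: "\<And>x. x \<in> space M \<Longrightarrow> 0 \<le> w x"
    and s_w: "\<And>x. x \<in> space M \<Longrightarrow> 1 \<le> s x * (w x)\<^sup>2"
begin

abbreviation "m \<equiv> expectation s"
abbreviation "W \<equiv> expectation w"
abbreviation "P n \<equiv> PiM {1..n} (\<lambda>_::nat. M)"

definition d :: "'a \<Rightarrow> real" where "d t = s t - m"

sublocale P: product_sigma_finite "\<lambda>_::nat. M"
  by standard

lemma w_meas [measurable]: "w \<in> borel_measurable M"
  using w_int by simp

lemma d_meas [measurable]: "d \<in> borel_measurable M"
  unfolding d_def by simp

lemma integrable_f: "integrable M f"
  using f_bounds by (intro integrable_const_bound[of _ 1]) auto

lemma integrable_s: "integrable M s"
  using s_bounds by (intro integrable_const_bound[of _ 1]) (auto simp: less_imp_le)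

lemma m_pos: "0 < m"
proof -
  have "0 \<le> m" using s_bounds by (intro Bochner_Integration.integral_nonneg) (auto simp: less_imp_le)
  moreover have "m \<noteq> 0"
  proof
    assume "m = 0"
    then have "AE x in M. s x = 0"
      using integrable_s s_bounds by (subst (asm) integral_nonneg_eq_0_iff_AE) (auto simp: less_imp_le)
    moreover have "AE x in M. 0 < s x" using s_bounds by (intro AE_I2) auto
    ultimately have "AE x in M. False" by eventually_elim simp
    then show False by simp
  qed
  ultimately show ?thesis by simp
qed

lemma m_le_1: "m \<le> 1"
  using integral_mono[OF integrable_s integrable_const[of 1]] s_bounds by (simp add: prob_space)

lemma abs_d_le_1: "x \<in> space M \<Longrightarrow> \<bar>d x\<bar> \<le> 1"
  using s_bounds[of x] m_pos m_le_1 by (auto simp: d_def abs_le_iff)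

lemma integrable_d: "integrable M d"
  unfolding d_def using integrable_s by simp

lemma integral_d: "expectation d = 0"
  unfolding d_def using integrable_s by (simp add: prob_space)

lemma P_space: "x \<in> space (P n) \<Longrightarrow> i \<in> {1..n} \<Longrightarrow> x i \<in> space M"
  by (auto simp: space_PiM PiE_iff)

lemma integrable_prod:
  assumes "\<And>q. q \<in> {1..n} \<Longrightarrow> integrable M (\<phi> q)"
  shows "integrable (P n) (\<lambda>x. \<Prod>q\<in>{1..n}. \<phi> q (x q) :: real)"
  using assms by (intro P.product_integrable_prod) auto

lemma integral_prod:
  assumes "\<And>q. q \<in> {1..n} \<Longrightarrow> integrable M (\<phi> q)"
  shows "(\<integral>x. (\<Prod>q\<in>{1..n}. \<phi> q (x q) :: real) \<partial>P n) = (\<Prod>q\<in>{1..n}. expectation (\<phi> q))"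
  using assms by (intro P.product_integral_prod) auto

text \<open>
  All moments below are read off from products over all coordinates, with factor \<open>1\<close> in the coordinates that
  do not occur.
\<close>

lemma integral_coordinate:
  assumes i: "i \<in> {1..n}" and g: "integrable M g"
  shows "integrable (P n) (\<lambda>x. g (x i) :: real)" "(\<integral>x. g (x i) \<partial>P n) = expectation g"
proof -
  have g': "integrable M (\<lambda>t. if q = i then g t else 1)" for q
    using g by (cases "q = i") auto
  have eq: "(\<Prod>q\<in>{1..n}. if q = i then g (x q) else 1) = g (x i)" for x
    using i by (simp add: prod.delta)
  show "integrable (P n) (\<lambda>x. g (x i))"
    using integrable_prod[of n "\<lambda>q t. if q = i then g t else 1"] g' by (simp only: eq)
  have "(\<integral>x. g (x i) \<partial>P n) = (\<Prod>q\<in>{1..n}. expectation (\<lambda>t. if q = i then g t else 1))"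
    using integral_prod[of n "\<lambda>q t. if q = i then g t else 1"] g' by (simp only: eq)
  also have "\<dots> = (\<Prod>q\<in>{1..n}. if q = i then expectation g else 1)"
    by (intro prod.cong) (auto simp: prob_space)
  finally show "(\<integral>x. g (x i) \<partial>P n) = expectation g" using i by (simp add: prod.delta)
qed

lemma integral_pair:
  assumes ij: "i \<in> {1..n}" "j \<in> {1..n}" "i \<noteq> j" and g: "integrable M g" and h: "integrable M h"
  shows "integrable (P n) (\<lambda>x. g (x i) * h (x j) :: real)"
    and "(\<integral>x. g (x i) * h (x j) \<partial>P n) = expectation g * expectation h"
proof -
  let ?\<phi> = "\<lambda>q t. (if q = i then g t else 1) * (if q = j then h t else 1)"
  have int: "integrable M (?\<phi> q)" for q
    using ij(3) g h by (cases "q = i"; cases "q = j") auto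
  have eq: "(\<Prod>q\<in>{1..n}. ?\<phi> q (x q)) = g (x i) * h (x j)" for x
    using ij by (simp add: prod.distrib prod.delta)
  show "integrable (P n) (\<lambda>x. g (x i) * h (x j))"
    using integrable_prod[of n ?\<phi>] int by (simp only: eq)
  have "(\<integral>x. g (x i) * h (x j) \<partial>P n) = (\<Prod>q\<in>{1..n}. expectation (?\<phi> q))"
    using integral_prod[of n ?\<phi>] int by (simp only: eq)
  also have "\<dots> = (\<Prod>q\<in>{1..n}. (if q = i then expectation g else 1) * (if q = j then expectation h else 1))"
    using ij by (intro prod.cong) (auto simp: prob_space)
  finally show "(\<integral>x. g (x i) * h (x j) \<partial>P n) = expectation g * expectation h"
    using ij by (simp add: prod.distrib prod.delta)
qed

lemma weighted_product_le:
  assumes kl: "k \<in> {1..n}" "l \<in> {1..n}" and ij: "i \<in> {1..n}" "j \<in> {1..n}" "i \<noteq> j"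
  shows "integrable (P n) (\<lambda>x. d (x k) * d (x l) * (w (x i) * w (x j)))"
    and "(\<integral>x. d (x k) * d (x l) * (w (x i) * w (x j)) \<partial>P n) \<le> W\<^sup>2"
proof -
  note [measurable] = kl ij(1,2)
  have ww: "integrable (P n) (\<lambda>x. w (x i) * w (x j))"
    and ww': "(\<integral>x. w (x i) * w (x j) \<partial>P n) = W\<^sup>2"
    using integral_pair[OF ij w_int w_int] by (simp_all add: power2_eq_square)
  have le: "\<bar>d (x k) * d (x l) * (w (x i) * w (x j))\<bar> \<le> w (x i) * w (x j)" if x: "x \<in> space (P n)" for x
  proof -
    have "\<bar>d (x k)\<bar> * \<bar>d (x l)\<bar> \<le> 1"
      using abs_d_le_1[OF P_space[OF x kl(1)]] abs_d_le_1[OF P_space[OF x kl(2)]]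
      by (intro mult_le_one) auto
    moreover have "0 \<le> w (x i) * w (x j)"
      using w_nonneg P_space[OF x] ij by simp
    ultimately show ?thesis
      using mult_right_mono[of "\<bar>d (x k)\<bar> * \<bar>d (x l)\<bar>" 1 "w (x i) * w (x j)"]
      by (simp only: abs_mult[of "_ * d _"] abs_mult[of "d _"] abs_of_nonneg mult_1)
  qed
  show int: "integrable (P n) (\<lambda>x. d (x k) * d (x l) * (w (x i) * w (x j)))"
  proof (rule Bochner_Integration.integrable_bound[OF ww])
    show "(\<lambda>x. d (x k) * d (x l) * (w (x i) * w (x j))) \<in> borel_measurable (P n)"
      by measurable
    show "AE x in P n. norm (d (x k) * d (x l) * (w (x i) * w (x j))) \<le> norm (w (x i) * w (x j))"
      using le by (intro AE_I2) fastforce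
  qed
  show "(\<integral>x. d (x k) * d (x l) * (w (x i) * w (x j)) \<partial>P n) \<le> W\<^sup>2"
    unfolding ww'[symmetric] using le by (intro integral_mono[OF int ww]) fastforce
qed

text \<open>
  The coordinate \<open>k\<close> carries only the factor \<open>d\<close>, which has mean zero.
\<close>

lemma weighted_product_eq_0:
  assumes kl: "k \<in> {1..n}" "l \<in> {1..n}" and ij: "i \<in> {1..n}" "j \<in> {1..n}" "i \<noteq> j"
    and k: "k \<notin> {i, j, l}"
  shows "(\<integral>x. d (x k) * d (x l) * (w (x i) * w (x j)) \<partial>P n) = 0"
proof -
  let ?\<phi> = "\<lambda>q t. (if q = k then d t else 1) * (if q = l then d t else 1) *
      ((if q = i then w t else 1) * (if q = j then w t else 1))"
  have dw: "integrable M (\<lambda>t. d t * w t)"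
  proof (rule Bochner_Integration.integrable_bound[OF w_int])
    show "AE x in M. norm (d x * w x) \<le> norm (w x)"
      using abs_d_le_1 by (intro AE_I2) (auto simp: abs_mult intro!: mult_left_le_one_le)
  qed simp
  have int: "integrable M (?\<phi> q)" for q
    using ij(3) k w_int dw integrable_d
    by (cases "q = k"; cases "q = l"; cases "q = i"; cases "q = j") auto
  have eq: "(\<Prod>q\<in>{1..n}. ?\<phi> q (x q)) = d (x k) * d (x l) * (w (x i) * w (x j))" for x
    using ij kl by (simp add: prod.distrib prod.delta)
  have "(\<integral>x. d (x k) * d (x l) * (w (x i) * w (x j)) \<partial>P n) = (\<Prod>q\<in>{1..n}. expectation (?\<phi> q))"
    using integral_prod[of n ?\<phi>] int by (simp only: eq)
  also have "\<dots> = 0"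
    using kl k by (intro prod_zero bexI[of _ k]) (auto simp: integral_d)
  finally show ?thesis .
qed

text \<open>
  Of the \<open>n\<^sup>2\<close> terms of the expanded square, at most the \<open>n\<close> diagonal ones and the four with both
  indices in \<open>{i, j}\<close> are nonzero.
\<close>

lemma weighted_variance_le:
  assumes ij: "i \<in> {1..n}" "j \<in> {1..n}" "i \<noteq> j"
  shows "integrable (P n) (\<lambda>x. (\<Sum>k=1..n. d (x k))\<^sup>2 * (w (x i) * w (x j)))"
    and "(\<integral>x. (\<Sum>k=1..n. d (x k))\<^sup>2 * (w (x i) * w (x j)) \<partial>P n) \<le> (real n + 4) * W\<^sup>2"
proof -
  have eq: "(\<Sum>k=1..n. d (x k))\<^sup>2 * (w (x i) * w (x j)) =
      (\<Sum>k=1..n. \<Sum>l=1..n. d (x k) * d (x l) * (w (x i) * w (x j)))" for x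
    by (simp only: power2_eq_square sum_product) (simp add: sum_distrib_right)
  show "integrable (P n) (\<lambda>x. (\<Sum>k=1..n. d (x k))\<^sup>2 * (w (x i) * w (x j)))"
    unfolding eq using weighted_product_le(1)[OF _ _ ij]
    by (intro Bochner_Integration.integrable_sum)
  have "(\<integral>x. (\<Sum>k=1..n. d (x k))\<^sup>2 * (w (x i) * w (x j)) \<partial>P n)
      = (\<Sum>k=1..n. \<Sum>l=1..n. \<integral>x. d (x k) * d (x l) * (w (x i) * w (x j)) \<partial>P n)"
    unfolding eq using weighted_product_le(1)[OF _ _ ij]
    by (rule integral_double_sum)
  also have "\<dots> \<le> (\<Sum>k=1..n. \<Sum>l=1..n. (if k = l then W\<^sup>2 else 0) +
      of_bool (k \<in> {i, j}) * (of_bool (l \<in> {i, j}) * W\<^sup>2))"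
  proof (intro sum_mono)
    fix k l assume kl: "k \<in> {1..n}" "l \<in> {1..n}"
    let ?J = "\<integral>x. d (x k) * d (x l) * (w (x i) * w (x j)) \<partial>P n"
    consider "k = l" | "k \<noteq> l" "k \<in> {i, j}" "l \<in> {i, j}" | "k \<notin> {i, j, l}" | "l \<notin> {i, j, k}"
      by blast
    then show "?J \<le> (if k = l then W\<^sup>2 else 0) +
      of_bool (k \<in> {i, j}) * (of_bool (l \<in> {i, j}) * W\<^sup>2)"
    proof cases
      case 3
      then show ?thesis using weighted_product_eq_0[OF kl ij] by auto
    next
      case 4
      then show ?thesis using weighted_product_eq_0[OF kl(2,1) ij] by (auto simp: mult.commute[of "d (_ l)"])
    qed (use weighted_product_le(2)[OF kl ij] in \<open>auto simp: add_increasing2\<close>)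
  qed
  also have "\<dots> = real n * W\<^sup>2 +
      (\<Sum>k=1..n. of_bool (k \<in> {i, j})) * ((\<Sum>l=1..n. of_bool (l \<in> {i, j})) * W\<^sup>2)"
    by (simp only: sum.distrib flip: sum_distrib_left sum_distrib_right) simp
  also have "(\<Sum>k=1..n. of_bool (k \<in> {i, j})) = (2 :: real)"
  proof -
    have "{1..n} \<inter> {k. k \<in> {i, j}} = {i, j}" using ij by auto
    then show ?thesis using ij(3) by (simp only: sum_of_bool_eq finite_atLeastAtMost) simp
  qed
  finally show "(\<integral>x. (\<Sum>k=1..n. d (x k))\<^sup>2 * (w (x i) * w (x j)) \<partial>P n) \<le> (real n + 4) * W\<^sup>2"
    by (simp add: algebra_simps)
qed

lemma covariance_le:
  shows "integrable (P n) (\<lambda>x. (\<Sum>k=1..n. f (x k)) * (\<Sum>k=1..n. d (x k)))"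
    and "\<bar>\<integral>x. (\<Sum>k=1..n. f (x k)) * (\<Sum>k=1..n. d (x k)) \<partial>P n\<bar> \<le> real n"
proof -
  have fd: "integrable M (\<lambda>t. f t * d t)" and fd1: "\<bar>expectation (\<lambda>t. f t * d t)\<bar> \<le> 1"
  proof -
    have b: "\<bar>f t * d t\<bar> \<le> 1" if "t \<in> space M" for t
      using f_bounds[OF that] abs_d_le_1[OF that] by (simp add: abs_mult mult_le_one)
    show *: "integrable M (\<lambda>t. f t * d t)"
      using b by (intro integrable_const_bound[of _ 1]) auto
    have "\<bar>expectation (\<lambda>t. f t * d t)\<bar> \<le> expectation (\<lambda>t. \<bar>f t * d t\<bar>)"
      by (rule integral_abs_bound)
    also have "\<dots> \<le> expectation (\<lambda>_. 1)"
      using b * by (intro integral_mono) auto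
    finally show "\<bar>expectation (\<lambda>t. f t * d t)\<bar> \<le> 1" by (simp add: prob_space)
  qed
  have int: "integrable (P n) (\<lambda>x. f (x k) * d (x l))"
    and val: "(\<integral>x. f (x k) * d (x l) \<partial>P n) = (if k = l then expectation (\<lambda>t. f t * d t) else 0)"
    if "k \<in> {1..n}" "l \<in> {1..n}" for k l
    using integral_coordinate[OF that(1) fd] integral_pair[OF that _ integrable_f integrable_d]
    by (auto simp: integral_d)
  have eq: "(\<Sum>k=1..n. f (x k)) * (\<Sum>k=1..n. d (x k)) = (\<Sum>k=1..n. \<Sum>l=1..n. f (x k) * d (x l))" for x
    by (simp add: sum_product)
  show "integrable (P n) (\<lambda>x. (\<Sum>k=1..n. f (x k)) * (\<Sum>k=1..n. d (x k)))"
    unfolding eq using int by (intro Bochner_Integration.integrable_sum)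
  have "(\<integral>x. (\<Sum>k=1..n. f (x k)) * (\<Sum>k=1..n. d (x k)) \<partial>P n) =
      (\<Sum>k=1..n. \<Sum>l=1..n. \<integral>x. f (x k) * d (x l) \<partial>P n)"
    unfolding eq using int
    by (rule integral_double_sum)
  also have "\<dots> = (\<Sum>k=1..n. \<Sum>l=1..n. if k = l then expectation (\<lambda>t. f t * d t) else 0)"
    by (intro sum.cong refl val)
  also have "\<dots> = real n * expectation (\<lambda>t. f t * d t)"
    by simp
  finally show "\<bar>\<integral>x. (\<Sum>k=1..n. f (x k)) * (\<Sum>k=1..n. d (x k)) \<partial>P n\<bar> \<le> real n"
    using fd1 by (simp add: abs_mult mult_left_le)
qed

text \<open>
  In the proof \<open>A\<close>, \<open>S\<close> and \<open>D = S - c\<close> are the sums of \<open>f\<close>, \<open>s\<close> and \<open>d\<close>, and \<open>R\<close> is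
  the remainder in \<open>divide_expand\<close>.  Integrability of the ratio, which fails in general for \<open>n = 1\<close>,
  comes from the majorant \<open>C * B\<close> of \<open>R\<close>.
\<close>

lemma ratio_bound:
  assumes n: "2 \<le> n"
  shows "integrable (P n) (\<lambda>x. (\<Sum>k=1..n. f (x k)) / (\<Sum>k=1..n. s (x k)))"
    and "\<bar>(\<integral>x. (\<Sum>k=1..n. f (x k)) / (\<Sum>k=1..n. s (x k)) \<partial>P n) - expectation f / m\<bar>
      \<le> (1 / real n + (real n + 4) * W\<^sup>2 / (real n * (real n - 1))) / m\<^sup>2"
proof -
  define A where "A x = (\<Sum>k=1..n. f (x k))" for x
  define S where "S x = (\<Sum>k=1..n. s (x k))" for x
  define D where "D x = (\<Sum>k=1..n. d (x k))" for x
  define c where "c = real n * m"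
  define R where "R x = A x * (D x)\<^sup>2 / (c\<^sup>2 * S x)" for x
  define B where "B x = (\<Sum>i=1..<n. (D x)\<^sup>2 * (w (x i) * w (x (Suc i))))" for x
  define C where "C = real n / (c\<^sup>2 * (real n - 1)\<^sup>2)"
  have [measurable]: "A \<in> borel_measurable (P n)" "S \<in> borel_measurable (P n)" "D \<in> borel_measurable (P n)"
    unfolding A_def S_def D_def by measurable
  have c: "0 < c" using n m_pos by (simp add: c_def)
  have SD: "S x - c = D x" for x
    by (simp add: S_def D_def d_def c_def sum_subtractf)
  have Spos: "0 < S x" if "x \<in> space (P n)" for x
    unfolding S_def using n s_bounds P_space[OF that] by (intro sum_pos) auto
  have A: "0 \<le> A x" "A x \<le> real n" if "x \<in> space (P n)" for x
  proof -
    show "0 \<le> A x" unfolding A_def using f_bounds P_space[OF that] by (intro sum_nonneg) auto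
    have "A x \<le> (\<Sum>k=1..n. 1)" unfolding A_def using f_bounds P_space[OF that] by (intro sum_mono) auto
    then show "A x \<le> real n" by simp
  qed
  have expand: "A x / S x = A x / c - A x * D x / c\<^sup>2 + R x" if "x \<in> space (P n)" for x
    using divide_expand[of "S x" c "A x"] Spos[OF that] c by (simp add: SD R_def)
  have R0: "0 \<le> R x" if "x \<in> space (P n)" for x
    unfolding R_def using A(1)[OF that] Spos[OF that] by simp
  have RB: "R x \<le> C * B x" if x: "x \<in> space (P n)" for x
  proof -
    have "1 / S x \<le> (\<Sum>i=1..<n. w (x i) * w (x (Suc i))) / (real n - 1)\<^sup>2"
      unfolding S_def using P_space[OF x] n s_bounds w_nonneg s_w
      by (intro inverse_sum_le_sum_neighbours) auto
    then have "A x * (D x)\<^sup>2 / c\<^sup>2 * (1 / S x)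
        \<le> real n * (D x)\<^sup>2 / c\<^sup>2 * ((\<Sum>i=1..<n. w (x i) * w (x (Suc i))) / (real n - 1)\<^sup>2)"
      using A[OF x] Spos[OF x]
      by (intro mult_mono divide_right_mono mult_right_mono) auto
    then show ?thesis
      by (simp add: R_def C_def B_def sum_distrib_left sum_divide_distrib mult_ac)
  qed
  have Bint: "integrable (P n) B"
    unfolding B_def D_def
    by (intro Bochner_Integration.integrable_sum weighted_variance_le) auto
  have "(\<integral>x. B x \<partial>P n) = (\<Sum>i=1..<n. \<integral>x. (D x)\<^sup>2 * (w (x i) * w (x (Suc i))) \<partial>P n)"
    unfolding B_def D_def
    by (intro Bochner_Integration.integral_sum weighted_variance_le) auto
  also have "\<dots> \<le> (\<Sum>i=1..<n. (real n + 4) * W\<^sup>2)"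
    unfolding D_def by (intro sum_mono weighted_variance_le) auto
  also have "\<dots> = (real n - 1) * ((real n + 4) * W\<^sup>2)"
    using n by (simp add: of_nat_diff)
  finally have Bval: "(\<integral>x. B x \<partial>P n) \<le> (real n - 1) * ((real n + 4) * W\<^sup>2)" .
  have Rint: "integrable (P n) R"
  proof (rule Bochner_Integration.integrable_bound[of _ "\<lambda>x. C * B x"])
    show "integrable (P n) (\<lambda>x. C * B x)" using Bint by simp
    show "R \<in> borel_measurable (P n)" unfolding R_def by measurable
    show "AE x in P n. norm (R x) \<le> norm (C * B x)"
      using R0 RB by (intro AE_I2) fastforce
  qed
  have Rval: "(\<integral>x. R x \<partial>P n) \<le> (real n + 4) * W\<^sup>2 / (real n * (real n - 1)) / m\<^sup>2"
  proof -
    have "(\<integral>x. R x \<partial>P n) \<le> (\<integral>x. C * B x \<partial>P n)"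
      using Rint Bint RB by (intro integral_mono) auto
    also have "\<dots> = C * (\<integral>x. B x \<partial>P n)" by simp
    also have "\<dots> \<le> C * ((real n - 1) * ((real n + 4) * W\<^sup>2))"
      using Bval by (intro mult_left_mono) (auto simp: C_def)
    also have "\<dots> = (real n + 4) * W\<^sup>2 / (real n * (real n - 1)) / m\<^sup>2"
      using n m_pos by (simp add: C_def c_def divide_simps power2_eq_square)
    finally show ?thesis .
  qed
  have R0': "0 \<le> (\<integral>x. R x \<partial>P n)"
    using R0 by (intro Bochner_Integration.integral_nonneg) auto
  have Aint: "integrable (P n) A" and Aval: "(\<integral>x. A x \<partial>P n) = real n * expectation f"
    unfolding A_def using integral_coordinate[OF _ integrable_f]
    by (auto simp: Bochner_Integration.integral_sum)
  have ADint: "integrable (P n) (\<lambda>x. A x * D x)" and ADval: "\<bar>\<integral>x. A x * D x \<partial>P n\<bar> \<le> real n"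
    unfolding A_def D_def by (rule covariance_le)+
  have "integrable (P n) (\<lambda>x. A x / c - A x * D x / c\<^sup>2 + R x)"
    using Aint ADint Rint by simp
  then show "integrable (P n) (\<lambda>x. (\<Sum>k=1..n. f (x k)) / (\<Sum>k=1..n. s (x k)))"
    unfolding A_def[symmetric] S_def[symmetric]
    by (rule Bochner_Integration.integrable_cong[THEN iffD1, rotated -1]) (auto simp: expand)
  have "(\<integral>x. A x / S x \<partial>P n) = (\<integral>x. A x / c - A x * D x / c\<^sup>2 + R x \<partial>P n)"
    by (intro Bochner_Integration.integral_cong) (auto simp: expand)
  also have "\<dots> = real n * expectation f / c - (\<integral>x. A x * D x \<partial>P n) / c\<^sup>2 + (\<integral>x. R x \<partial>P n)"
    using Aint ADint Rint by (simp add: Aval del: One_nat_def)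
  also have "real n * expectation f / c = expectation f / m"
    using n by (simp add: c_def)
  finally have E: "(\<integral>x. A x / S x \<partial>P n) - expectation f / m
      = (\<integral>x. R x \<partial>P n) - (\<integral>x. A x * D x \<partial>P n) / c\<^sup>2" by simp
  have "\<bar>(\<integral>x. A x * D x \<partial>P n) / c\<^sup>2\<bar> \<le> real n / c\<^sup>2"
    using ADval by (simp add: divide_right_mono)
  also have "\<dots> = 1 / real n / m\<^sup>2"
    using n by (simp add: c_def power2_eq_square)
  finally show "\<bar>(\<integral>x. (\<Sum>k=1..n. f (x k)) / (\<Sum>k=1..n. s (x k)) \<partial>P n) - expectation f / m\<bar>
      \<le> (1 / real n + (real n + 4) * W\<^sup>2 / (real n * (real n - 1))) / m\<^sup>2"
    unfolding A_def[symmetric] S_def[symmetric] E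
    using Rval R0' unfolding add_divide_distrib by linarith
qed

theorem ratio_tendsto:
  "(\<lambda>n. \<integral>\<^sup>+x. ennreal ((\<Sum>k=1..n. f (x k)) / (\<Sum>k=1..n. s (x k))) \<partial>P n)
     \<longlonglongrightarrow> ennreal (expectation f / m)"
proof -
  let ?E = "\<lambda>n. \<integral>x. (\<Sum>k=1..n. f (x k)) / (\<Sum>k=1..n. s (x k)) \<partial>P n"
  let ?b = "\<lambda>n::nat. (1 / real n + (real n + 4) * W\<^sup>2 / (real n * (real n - 1))) / m\<^sup>2"
  have "(\<lambda>n. 1 / real n) \<longlonglongrightarrow> 0" "(\<lambda>n. (real n + 4) / (real n * (real n - 1))) \<longlonglongrightarrow> 0"
    by real_asymp+
  then have "(\<lambda>n. (1 / real n + (real n + 4) / (real n * (real n - 1)) * W\<^sup>2) / m\<^sup>2) \<longlonglongrightarrow> (0 + 0 * W\<^sup>2) / m\<^sup>2"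
    using m_pos by (intro tendsto_intros) auto
  then have "?b \<longlonglongrightarrow> 0" by simp
  moreover have "eventually (\<lambda>n. norm (?E n - expectation f / m) \<le> ?b n) sequentially"
    using eventually_ge_at_top[of 2] by eventually_elim (use ratio_bound(2) in simp)
  ultimately have "(\<lambda>n. ?E n - expectation f / m) \<longlonglongrightarrow> 0"
    by (rule Lim_null_comparison[rotated])
  then have "?E \<longlonglongrightarrow> expectation f / m"
    by (rule LIM_zero_cancel)
  then have "(\<lambda>n. ennreal (?E n)) \<longlonglongrightarrow> ennreal (expectation f / m)"
    by (rule tendsto_ennrealI)
  moreover have "eventually (\<lambda>n. ennreal (?E n) =
      (\<integral>\<^sup>+x. ennreal ((\<Sum>k=1..n. f (x k)) / (\<Sum>k=1..n. s (x k))) \<partial>P n)) sequentially"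
    using eventually_ge_at_top[of 2]
  proof eventually_elim
    case (elim n)
    have "AE x in P n. 0 \<le> (\<Sum>k=1..n. f (x k)) / (\<Sum>k=1..n. s (x k))"
      using f_bounds s_bounds P_space
      by (intro AE_I2 divide_nonneg_nonneg sum_nonneg) (auto simp: less_imp_le)
    then show ?case
      using ratio_bound(1)[OF elim] by (intro nn_integral_eq_integral[symmetric])
  qed
  ultimately show ?thesis
    by (rule Lim_transform_eventually)
qed

end

section \<open>The uniform distribution on the unit interval\<close>

abbreviation unit_interval :: "real measure" where
  "unit_interval \<equiv> restrict_space lborel {0<..<1}"

lemma prob_space_unit_interval: "prob_space unit_interval"
  by (rule prob_space_restrict_space) auto

lemma has_integral_unit_interval:
  fixes g :: "real \<Rightarrow> real"
  assumes [measurable]: "g \<in> borel_measurable borel" and nonneg: "\<And>x. x \<in> {0<..<1} \<Longrightarrow> 0 \<le> g x"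
    and g: "(g has_integral c) {0..1}"
  shows "has_bochner_integral unit_interval g c"
proof -
  have g': "(g has_integral c) {0<..<1}"
    using g by (simp add: has_integral_Icc_iff_Ioo)
  have c: "0 \<le> c" using has_integral_nonneg[OF g'] nonneg by auto
  have "(\<integral>\<^sup>+x. ennreal (g x) \<partial>unit_interval) = (\<integral>\<^sup>+x. ennreal (g x) * indicator {0<..<1} x \<partial>lborel)"
    by (rule nn_integral_restrict_space) simp
  also have "\<dots> = ennreal c"
    using nonneg g' by (rule nn_integral_has_integral_lebesgue')
  finally show ?thesis
    using nonneg c by (intro has_bochner_integral_nn_integral) (auto intro!: measurable_restrict_space1)
qed

lemma has_integral_powr_unit:
  fixes a :: real assumes "0 \<le> a"
  shows "((\<lambda>x. x powr a) has_integral 1 / (a + 1)) {0..1}"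
  using has_integral_powr_from_0[of a 1] assms by simp

lemma has_integral_sin_pi: "((\<lambda>x. sin (pi * x)) has_integral 2 / pi) {0..1}"
proof -
  have "((\<lambda>x. sin (pi * x)) has_integral (- cos (pi * 1) / pi - (- cos (pi * 0) / pi))) {0..1}"
    by (rule fundamental_theorem_of_calculus)
      (auto intro!: derivative_eq_intros simp flip: has_real_derivative_iff_has_vector_derivative)
  then show ?thesis by simp
qed

text \<open>
  On \<open>[0, 1/2]\<close> the sine lies above its chord \<open>2 * x\<close>; the other half follows by symmetry.
\<close>

lemma sin_pi_ge:
  assumes x: "x \<in> {0..1}"
  shows "x * (1 - x) \<le> sin (pi * x)"
proof -
  have conc: "concave_on {0..pi} sin"
    by (rule f''_le0_imp_concave[where f' = cos and f'' = "\<lambda>x. - sin x"])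
      (auto intro!: derivative_eq_intros sin_ge_zero)
  have half: "2 * y \<le> sin (pi * y)" if y: "0 \<le> y" "y \<le> 1/2" for y :: real
    using concave_onD[OF conc, of "2 * y" 0 "pi / 2"] y by (simp add: algebra_simps)
  show ?thesis
  proof (cases "x \<le> 1/2")
    case True
    have "x * (1 - x) \<le> x" using x by (simp add: mult_left_le)
    then show ?thesis using half[of x] True x by simp
  next
    case False
    have "x * (1 - x) \<le> 1 - x" using x by (simp add: mult_left_le_one_le)
    moreover have "sin (pi * (1 - x)) = sin (pi * x)"
      by (simp add: algebra_simps sin_diff)
    ultimately show ?thesis using half[of "1 - x"] False x by simp
  qed
qed

theorem mainTheorem3:
  fixes a :: real
  assumes "a \<ge> 0"
  shows "(\<lambda>n. I n a) \<longlonglongrightarrow> ennreal (pi / (2 * (a + 1)))"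
proof -
  \<comment> \<open>\<open>1 / sqrt (x * (1 - x))\<close>, in the form of the Beta integrand\<close>
  let ?w = "\<lambda>x::real. x powr (1/2 - 1) * (1 - x) powr (1/2 - 1)"
  have f: "has_bochner_integral unit_interval (\<lambda>x. x powr a) (1 / (a + 1))"
    by (intro has_integral_unit_interval has_integral_powr_unit assms) auto
  have s: "has_bochner_integral unit_interval (\<lambda>x. sin (pi * x)) (2 / pi)"
    by (intro has_integral_unit_interval has_integral_sin_pi)
      (auto intro!: sin_ge_zero)
  have w: "has_bochner_integral unit_interval ?w (Beta (1/2) (1/2))"
    by (intro has_integral_unit_interval has_integral_Beta_real) auto
  interpret U: ratio_of_sums unit_interval "\<lambda>x. x powr a" "\<lambda>x. sin (pi * x)" ?w
  proof (intro ratio_of_sums.intro ratio_of_sums_axioms.intro prob_space_unit_interval)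
    fix x :: real assume "x \<in> space unit_interval"
    then have x: "0 < x" "x < 1" by auto
    show "0 \<le> x powr a \<and> x powr a \<le> 1" using x assms by (auto intro: powr_le1)
    show "0 < sin (pi * x) \<and> sin (pi * x) \<le> 1" using x by (auto intro!: sin_gt_zero)
    show "0 \<le> ?w x" by simp
    have half: "(y powr (1/2 - 1))\<^sup>2 = 1 / y" if "0 < y" for y :: real
      using that by (simp add: power2_eq_square powr_minus_divide flip: powr_add)
    have "(?w x)\<^sup>2 = 1 / (x * (1 - x))"
      using x half[of x] half[of "1 - x"] by (simp only: power_mult_distrib) simp
    then show "1 \<le> sin (pi * x) * (?w x)\<^sup>2"
      using sin_pi_ge[of x] x by (simp add: le_divide_eq)
  qed (use f s w in \<open>auto simp: has_bochner_integral_iff\<close>)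
  have ratio: "(1 / (a + 1)) / (2 / pi) = pi / (2 * (a + 1))" by simp
  have "I n a = (\<integral>\<^sup>+x. ennreal ((\<Sum>k=1..n. x k powr a) / (\<Sum>k=1..n. sin (pi * x k)))
      \<partial>PiM {1..n} (\<lambda>_. unit_interval))" for n
  proof -
    have ps: "product_sigma_finite (\<lambda>_::nat. lborel :: real measure)" by standard
    have "open_unit_cube n \<in> sets (\<Pi>\<^sub>M i\<in>{1..n}. lborel)"
      unfolding open_unit_cube_def by (intro sets_PiM_I_finite) auto
    then show ?thesis
      unfolding I_def open_unit_cube_def
      by (subst restrict_space_PiM_PiE[OF _ ps, symmetric]) (auto simp: nn_integral_restrict_space)
  qed
  moreover have "U.expectation (\<lambda>x. x powr a) = 1 / (a + 1)" "U.m = 2 / pi"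
    using f s by (simp_all add: has_bochner_integral_iff)
  ultimately show ?thesis
    using U.ratio_tendsto by (simp only: ratio)
qed

end
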